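(* Let $\delta$ be a real number with $\delta > -\tfrac{3}{2}$. Then $$R(x) = O(x^{\delta+1}) \ \text{ as } x\to\infty \ (x \text{ real}) \quad\Longleftrightarrow\quad c_k = O(k^{\delta}) \ \text{ as } k\to\infty \ (k \text{ a positive integer}).$$
   Context: Let $\zeta$ denote the Riemann zeta function. For real $x$ define the Riesz function $$R(x) = x\sum_{k=0}^{\infty}\frac{(-1)^k x^k}{k!\,\zeta(2k+2)},$$ and for integers $k\ge 0$ define the Báez-Duarte sequence $$c_k=\sum_{j=0}^{k}(-1)^j\binom{k}{j}\frac{1}{\zeta(2j+2)}.$$ *)

theory Defs
  imports Complex_Main "HOL-Library.Landau_Symbols"
begin

text \<open>
  The Dirichlet series represents the Riemann zeta function for \<open>s > 1\<close> only;
  for other \<open>s\<close> the value below is meaningless. Only the arguments \<open>2, 4, 6, \<dots>\<close>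
  occur in what follows.
\<close>

definition zeta :: "real \<Rightarrow> real" where
  "zeta s = (\<Sum>n. 1 / real (Suc n) powr s)"

definition Riesz :: "real \<Rightarrow> real" where
  "Riesz x = x * (\<Sum>k. (- 1) ^ k * x ^ k / (fact k * zeta (2 * real k + 2)))"

definition Baez_Duarte :: "nat \<Rightarrow> real" where
  "Baez_Duarte k = (\<Sum>j\<le>k. (- 1) ^ j * real (k choose j) * (1 / zeta (2 * real j + 2)))"

end

theory Submission
  imports Defs "HOL-Analysis.Infinite_Sum" "HOL-Analysis.Summation_Tests"
    "HOL-Computational_Algebra.Squarefree"
begin

text \<open>
  Write \<open>1 / \<zeta>(s)\<close> as the Dirichlet series \<open>\<Sum> \<mu>(n) n\<^sup>-\<^sup>s\<close> and put \<open>u = 1 / n\<^sup>2\<close>. Exchanging sums turns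
  the two functions into sums of the same shape,
  \<open>R(x) / x = \<Sum> \<mu>(n) u exp (- x u)\<close> (\<open>Riesz_mobius\<close>) and
  \<open>c\<^sub>k = \<Sum> \<mu>(n) u (1 - u)\<^sup>k\<close> (\<open>Baez_Duarte_mobius\<close>), and \<open>(1 - u)\<^sup>k\<close> is close to \<open>exp (- x u)\<close>
  whenever \<open>k \<le> x \<le> k + 1\<close>. More precisely the two differ by at most a constant times
  \<open>u / (1 + (k u)\<^sup>2)\<close>. Since \<open>\<bar>\<mu>(n)\<bar> \<le> 1\<close>, the sums differ by at most a constant times
  \<open>\<Sum> u\<^sup>2 / (1 + (k u)\<^sup>2) = \<Sum> 1 / (n\<^sup>4 + k\<^sup>2)\<close>, and this is of the order of \<open>k\<close> to the power \<open>- 3 / 2\<close>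
  because about \<open>\<surd>k\<close> terms have the size \<open>1 / k\<^sup>2\<close> and the tail is no larger.

  Hence \<open>R(x) / x\<close> and \<open>c\<close> at \<open>\<lfloor>x\<rfloor>\<close> differ by \<open>O(x powr (- 3 / 2))\<close> unconditionally
  (\<open>Riesz_Baez_Duarte_close\<close>). For \<open>\<delta> > - 3 / 2\<close> this error is absorbed by \<open>x powr \<delta>\<close>, so that
  both bounds say the same.
\<close>

section \<open>The Moebius function and the reciprocal of zeta\<close>

definition mobius :: "nat \<Rightarrow> real" where
  "mobius n = (if squarefree n then (- 1) ^ card (prime_factors n) else 0)"

lemma abs_mobius_le_1: "\<bar>mobius n\<bar> \<le> 1"
  by (simp add: mobius_def power_abs)

lemma mobius_prime_mult:
  assumes "prime p" "\<not> p dvd d" "squarefree d"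
  shows "mobius (p * d) = - mobius d"
proof -
  have "d \<noteq> 0" using assms(2) by (metis dvd_0_right)
  moreover have "p \<noteq> 0" using assms by auto
  ultimately have "prime_factors (p * d) = insert p (prime_factors d)"
    using assms by (simp add: prime_factors_product prime_factorization_prime)
  moreover have "p \<notin> prime_factors d" using assms by auto
  moreover have "squarefree (p * d)"
    using assms by (intro squarefree_mult_coprime) (auto intro: squarefree_prime prime_imp_coprime)
  ultimately show ?thesis using assms by (simp add: mobius_def)
qed

text \<open>
  For a prime \<open>p\<close> dividing \<open>n\<close>, multiplication by \<open>p\<close> pairs the squarefree divisors of \<open>n\<close> that are
  prime to \<open>p\<close> with those divisible by \<open>p\<close>, and it changes the sign of \<open>\<mu>\<close>.
\<close>

lemma sum_mobius_divisors:
  assumes "n > 0"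
  shows "(\<Sum>d | d dvd n. mobius d) = (if n = 1 then 1 else 0)"
proof (cases "n = 1")
  case True
  then show ?thesis by (simp add: mobius_def)
next
  case False
  then obtain p where p: "prime p" "p dvd n" using prime_factor_nat by blast
  define S0 where "S0 = {d. d dvd n \<and> squarefree d \<and> \<not> p dvd d}"
  define S1 where "S1 = {d. d dvd n \<and> squarefree d \<and> p dvd d}"
  have fin: "finite {d. d dvd n}" using assms by simp
  have fin': "finite S0" "finite S1"
    by (auto simp: S0_def S1_def intro: finite_subset[OF _ fin])
  have "(\<Sum>d | d dvd n. mobius d) = (\<Sum>d\<in>S0 \<union> S1. mobius d)"
    by (intro sum.mono_neutral_right fin) (auto simp: S0_def S1_def mobius_def)
  also have "\<dots> = (\<Sum>d\<in>S0. mobius d) + (\<Sum>d\<in>S1. mobius d)"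
    by (intro sum.union_disjoint fin') (auto simp: S0_def S1_def)
  also have "(\<Sum>d\<in>S1. mobius d) = (\<Sum>d\<in>S0. - mobius d)"
  proof (rule sum.reindex_bij_witness[of _ "\<lambda>d. p * d" "\<lambda>d. d div p"])
    fix d assume d: "d \<in> S1"
    then obtain e where e: "d = p * e" by (auto simp: S1_def)
    have "\<not> p dvd e"
    proof
      assume "p dvd e"
      then have "p ^ 2 dvd d" by (simp add: e power2_eq_square)
      then have "p dvd 1" using d squarefreeD unfolding S1_def by blast
      with p show False by auto
    qed
    moreover have "e dvd n" using d by (auto simp: S1_def e dest: dvd_mult_right)
    moreover have "squarefree e" using d by (auto simp: S1_def e dest: squarefree_multD)
    moreover have p0: "p > 0" using p by (simp add: prime_gt_0_nat)
    ultimately show "d div p \<in> S0" "p * (d div p) = d" "- mobius (d div p) = mobius d"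
      using p by (simp_all add: S0_def e mobius_prime_mult)
  next
    fix d assume d: "d \<in> S0"
    have cop: "coprime p d" using p d by (auto simp: S0_def intro: prime_imp_coprime)
    have "p * d dvd n" using p d cop by (intro divides_mult) (auto simp: S0_def)
    moreover have "squarefree (p * d)"
      using p d cop by (intro squarefree_mult_coprime) (auto simp: S0_def intro: squarefree_prime)
    ultimately show "p * d \<in> S1" by (simp add: S1_def)
    show "p * d div p = d" using p by (simp add: prime_gt_0_nat)
  qed
  finally show ?thesis using False by (simp add: sum_negf)
qed

text \<open>
  A separated majorant makes a double family absolutely summable. This justifies both rearrangements
  below: the Dirichlet convolution of \<open>\<mu>\<close> with \<open>1\<close>, and the expansion of the Riesz function.
\<close>

lemma summable_on_product_majorant:
  fixes f :: "'a \<Rightarrow> 'b \<Rightarrow> real"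
  assumes a: "a summable_on A" "\<And>x. x \<in> A \<Longrightarrow> a x \<ge> 0"
    and b: "b summable_on B" "\<And>y. y \<in> B \<Longrightarrow> b y \<ge> 0"
    and le: "\<And>x y. x \<in> A \<Longrightarrow> y \<in> B \<Longrightarrow> \<bar>f x y\<bar> \<le> a x * b y"
  shows "(\<lambda>(x, y). f x y) summable_on A \<times> B"
proof -
  have "(\<lambda>(x, y). a x * b y) summable_on A \<times> B"
  proof (rule summable_on_SigmaI[where g = "\<lambda>x. a x * infsum b B"])
    show "((\<lambda>y. case (x, y) of (x, y) \<Rightarrow> a x * b y) has_sum a x * infsum b B) B" for x
      using b by (auto intro: has_sum_cmult_right)
    show "(\<lambda>x. a x * infsum b B) summable_on A"
      using a by (intro summable_on_cmult_left)
  qed (use a b in auto)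
  then have "(\<lambda>z. norm (case z of (x, y) \<Rightarrow> f x y)) summable_on A \<times> B"
    by (rule abs_summable_on_comparison_test') (use le in auto)
  then show ?thesis by (rule abs_summable_summable)
qed

lemma sums_exchange:
  fixes f :: "nat \<Rightarrow> nat \<Rightarrow> real"
  assumes a: "summable a" "\<And>k. a k \<ge> 0" and b: "summable b" "\<And>n. b n \<ge> 0"
    and le: "\<And>k n. \<bar>f k n\<bar> \<le> a k * b n"
    and rows: "\<And>k. f k sums r k" and cols: "\<And>n. (\<lambda>k. f k n) sums c n"
  shows "c sums (\<Sum>k. r k)"
proof -
  have "(\<lambda>(k, n). f k n) summable_on UNIV \<times> UNIV"
    using a b by (intro summable_on_product_majorant[where a = a and b = b] le)
      (auto intro: summable_nonneg_imp_summable_on)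
  then obtain S where S: "((\<lambda>(k, n). f k n) has_sum S) (UNIV \<times> UNIV)"
    by (auto simp: summable_on_def)
  have row: "(f k has_sum r k) UNIV" for k
  proof (rule norm_summable_imp_has_sum[OF _ rows])
    show "summable (\<lambda>n. norm (f k n))"
      by (rule summable_comparison_test'[where g = "\<lambda>n. a k * b n"])
        (use b le in \<open>auto intro: summable_mult\<close>)
  qed
  have col: "((\<lambda>k. f k n) has_sum c n) UNIV" for n
  proof (rule norm_summable_imp_has_sum[OF _ cols])
    show "summable (\<lambda>k. norm (f k n))"
      by (rule summable_comparison_test'[where g = "\<lambda>k. a k * b n"])
        (use a le in \<open>auto intro: summable_mult2\<close>)
  qed
  have "(r has_sum S) UNIV"
    using has_sum_SigmaD[OF S] row by simp
  then have "r sums S" by (rule has_sum_imp_sums)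
  moreover have "(c has_sum S) UNIV"
    using has_sum_SigmaD[OF has_sum_swap[THEN iffD1, OF S]] col by simp
  then have "c sums S" by (rule has_sum_imp_sums)
  ultimately show ?thesis by (simp add: sums_iff)
qed

lemma has_sum_positive_iff_Suc:
  "(f has_sum S) {0::nat<..} \<longleftrightarrow> ((\<lambda>n. f (Suc n)) has_sum S) UNIV"
proof -
  have "bij_betw Suc UNIV {0<..}"
    by (rule bij_betwI[where g = "\<lambda>n. n - 1"]) auto
  from has_sum_reindex_bij_betw[OF this, of f S] show ?thesis by simp
qed

lemma summable_zeta:
  assumes "s > (1::real)"
  shows "summable (\<lambda>n. 1 / real (Suc n) powr s)"
proof -
  have "summable (\<lambda>n. real n powr (- s))"
    using assms by (simp add: summable_real_powr_iff)
  then show ?thesis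
    by (subst (asm) summable_Suc_iff [symmetric]) (simp add: powr_minus_divide)
qed

text \<open>
  The product of the two Dirichlet series, regrouped according to the value \<open>n\<close> of the product of
  the indices, has the coefficients \<open>\<Sum>d dvd n. \<mu>(d)\<close>, which vanish except at \<open>n = 1\<close>.
\<close>

lemma mobius_dirichlet_series:
  assumes "s > (1::real)"
  shows "(\<lambda>n. mobius (Suc n) / real (Suc n) powr s) sums (1 / zeta s)"
proof -
  define P where "P = {0::nat<..}"
  define z where "z n = 1 / real n powr s" for n
  define m where "m n = mobius n * z n" for n
  have z_nonneg: "z n \<ge> 0" for n by (simp add: z_def)
  have z: "(z has_sum zeta s) P"
    unfolding P_def has_sum_positive_iff_Suc z_def zeta_def
    by (rule sums_nonneg_imp_has_sum[OF summable_sums[OF summable_zeta[OF assms]]]) simp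
  have m_le: "\<bar>m n\<bar> \<le> z n" for n
    using mult_right_mono[OF abs_mobius_le_1 z_nonneg] z_nonneg
    by (simp add: m_def abs_mult)
  have "m summable_on P"
    by (rule abs_summable_summable, rule abs_summable_on_comparison_test'[of z])
      (use z m_le in \<open>auto simp: summable_on_def\<close>)
  then obtain M where M: "(m has_sum M) P" by (auto simp: summable_on_def)
  have "(\<lambda>(d, e). m d * z e) summable_on P \<times> P"
    by (rule summable_on_product_majorant[of z _ z])
      (use z z_nonneg m_le in \<open>auto simp: summable_on_def abs_mult intro: mult_right_mono\<close>)
  then have "((\<lambda>(d, e). m d * z e) has_sum (M * zeta s)) (P \<times> P)"
    by (intro has_sum_SigmaI[where g = "\<lambda>d. m d * zeta s"])
      (auto intro: has_sum_cmult_right has_sum_cmult_left z M)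
  (* the pair (d, e) becomes the number n = d e together with its divisor d *)
  also have "?this \<longleftrightarrow>
      ((\<lambda>(n, d). mobius d * z n) has_sum (M * zeta s)) (Sigma P (\<lambda>n. {d. d dvd n}))"
    by (rule has_sum_reindex_bij_witness
          [where i = "\<lambda>(n, d). (d, n div d)" and j = "\<lambda>(d, e). (d * e, d)"])
      (auto simp: P_def m_def z_def powr_mult intro: dvd_pos_nat)
  finally have "((\<lambda>n. (\<Sum>d | d dvd n. mobius d) * z n) has_sum (M * zeta s)) P"
    by (rule has_sum_SigmaD)
      (auto simp: P_def sum_distrib_right intro!: has_sum_finiteI)
  also have "?this \<longleftrightarrow> ((\<lambda>n. if n = 1 then 1 else 0) has_sum (M * zeta s)) P"
    by (rule has_sum_cong) (auto simp: P_def sum_mobius_divisors z_def)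
  also have "\<dots> \<longleftrightarrow> ((\<lambda>n. 1) has_sum (M * zeta s)) {1::nat}"
    by (rule has_sum_cong_neutral) (auto simp: P_def)
  finally have "M * zeta s = 1"
    using has_sum_unique has_sum_finite[of "{1::nat}" "\<lambda>_. 1::real"] by fastforce
  then have "M = 1 / zeta s" by (metis mult_zero_right nonzero_eq_divide_eq zero_neq_one)
  then show ?thesis
    using M has_sum_imp_sums unfolding P_def has_sum_positive_iff_Suc m_def z_def by fastforce
qed

section \<open>Both functions as weighted sums over the Moebius function\<close>

text \<open>Index \<open>n\<close> stands for the integer \<open>n + 1\<close>, in line with the series that defines \<open>zeta\<close>.\<close>

definition inv_square :: "nat \<Rightarrow> real" where
  "inv_square n = 1 / real (Suc n) ^ 2"

lemma inv_square_bounds: "0 < inv_square n" "inv_square n \<le> 1"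
  by (simp_all add: inv_square_def)

lemma summable_inv_square: "summable inv_square"
proof -
  have "inv_square = (\<lambda>n. 1 / real (Suc n) powr 2)"
    by (rule ext) (simp add: inv_square_def)
  then show ?thesis using summable_zeta[of 2] by simp
qed

lemma mobius_series_even:
  "(\<lambda>n. mobius (Suc n) * inv_square n * inv_square n ^ k) sums (1 / zeta (2 * real k + 2))"
proof -
  have "real (Suc n) powr (2 * real k + 2) = (real (Suc n) ^ 2) ^ Suc k" for n
  proof -
    have "real (Suc n) powr (2 * real k + 2) = real (Suc n) powr real (2 * Suc k)"
      by (simp add: algebra_simps)
    then show ?thesis by (simp only: powr_realpow power_mult of_nat_0_less_iff zero_less_Suc)
  qed
  then have "mobius (Suc n) / real (Suc n) powr (2 * real k + 2)
      = mobius (Suc n) * inv_square n * inv_square n ^ k" for n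
    by (simp add: inv_square_def power_divide)
  then show ?thesis using mobius_dirichlet_series[of "2 * real k + 2"] by simp
qed

text \<open>The binomial theorem, applied for each index of the Dirichlet series separately.\<close>

lemma Baez_Duarte_mobius:
  "(\<lambda>n. mobius (Suc n) * inv_square n * (1 - inv_square n) ^ k) sums Baez_Duarte k"
proof -
  have "(\<lambda>n. \<Sum>j\<le>k. (- 1) ^ j * real (k choose j) * (mobius (Suc n) * inv_square n * inv_square n ^ j))
      sums Baez_Duarte k"
    unfolding Baez_Duarte_def by (intro sums_sum sums_mult mobius_series_even)
  moreover have "(\<Sum>j\<le>k. (- 1) ^ j * real (k choose j) * (c * u ^ j)) = c * (1 - u) ^ k"
    for c u :: real
    using binomial_ring[of "- u" 1 k]
    by (simp add: sum_distrib_left power_minus[of u] mult_ac)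
  ultimately show ?thesis by simp
qed

text \<open>
  The same with the exponential series in place of the binomial theorem. The double series is
  dominated by \<open>\<bar>x\<bar>\<^sup>k / k!\<close> times \<open>1 / n\<^sup>2\<close>.
\<close>

lemma Riesz_mobius:
  assumes "x \<noteq> 0"
  shows "(\<lambda>n. mobius (Suc n) * inv_square n * exp (- x * inv_square n)) sums (Riesz x / x)"
proof -
  let ?f = "\<lambda>k n. (- 1) ^ k * x ^ k / fact k * (mobius (Suc n) * inv_square n * inv_square n ^ k)"
  have "(\<lambda>n. mobius (Suc n) * inv_square n * exp (- x * inv_square n))
     sums (\<Sum>k. (- 1) ^ k * x ^ k / fact k * (1 / zeta (2 * real k + 2)))"
  proof (rule sums_exchange[where f = ?f and b = inv_square and a = "\<lambda>k. \<bar>x\<bar> ^ k / fact k"])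
    show "summable (\<lambda>k. \<bar>x\<bar> ^ k / fact k)"
      using summable_exp[of "\<bar>x\<bar>"] by (simp add: divide_inverse mult.commute)
    show "\<bar>?f k n\<bar> \<le> \<bar>x\<bar> ^ k / fact k * inv_square n" for k n
    proof -
      have "\<bar>mobius (Suc n)\<bar> * (inv_square n * inv_square n ^ k) \<le> 1 * (inv_square n * 1)"
        using inv_square_bounds[of n]
        by (intro mult_mono abs_mobius_le_1 power_le_one) auto
      then have "\<bar>x\<bar> ^ k / fact k * (\<bar>mobius (Suc n)\<bar> * (inv_square n * inv_square n ^ k))
          \<le> \<bar>x\<bar> ^ k / fact k * inv_square n"
        by (intro mult_left_mono) auto
      then show ?thesis
        using inv_square_bounds[of n] by (simp add: abs_mult power_abs mult_ac)
    qed
    show "?f k sums ((- 1) ^ k * x ^ k / fact k * (1 / zeta (2 * real k + 2)))" for k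
      by (intro sums_mult mobius_series_even)
    show "(\<lambda>k. ?f k n) sums (mobius (Suc n) * inv_square n * exp (- x * inv_square n))" for n
    proof -
      have "(\<lambda>k. (- x * inv_square n) ^ k /\<^sub>R fact k) sums exp (- x * inv_square n)"
        by (rule exp_converges)
      from sums_mult[OF this, of "mobius (Suc n) * inv_square n"] show ?thesis
        by (simp add: power_mult_distrib power_minus[of x] power_minus[of "x * _"] divide_inverse mult_ac)
    qed
  qed (auto simp: summable_inv_square less_imp_le[OF inv_square_bounds(1)])
  then show ?thesis using assms by (simp add: Riesz_def)
qed

section \<open>Comparison of the two sums\<close>

text \<open>
  Both \<open>exp (- x u)\<close> and \<open>(1 - u)\<^sup>k\<close> are at most \<open>E = exp (- k u)\<close>. From below, \<open>x \<le> k + 1\<close> gives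
  \<open>exp (- x u) \<ge> (1 - u) E\<close>, and \<open>(1 - u) exp u \<ge> 1 - u\<^sup>2\<close> with Bernoulli's inequality gives
  \<open>(1 - u)\<^sup>k \<ge> (1 - k u\<^sup>2) E\<close>. The bound is the sum of the two relative losses \<open>u\<close> and \<open>k u\<^sup>2\<close>,
  times \<open>E\<close>.
\<close>

lemma exp_minus_power_bound:
  fixes u x :: real
  assumes u: "0 \<le> u" "u \<le> 1" and x: "real k \<le> x" "x \<le> real k + 1"
  shows "\<bar>exp (- x * u) - (1 - u) ^ k\<bar> \<le> u * (1 + k * u) * exp (- (k * u))"
proof -
  let ?E = "exp (- (k * u))"
  have "(1 - u) * exp u \<ge> (1 - u) * (1 + u)"
    using u by (intro mult_left_mono exp_ge_add_one_self) auto
  then have "(1 - u) * exp u \<ge> 1 - u ^ 2"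
    by (simp add: algebra_simps power2_eq_square)
  then have "((1 - u) * exp u) ^ k \<ge> (1 - u ^ 2) ^ k"
    using u by (intro power_mono) (auto simp: power_le_one)
  moreover have "(1 - u ^ 2) ^ k \<ge> 1 - k * u ^ 2"
    using Bernoulli_inequality[of "- (u ^ 2)" k] u by (simp add: power_le_one)
  ultimately have "((1 - u) * exp u) ^ k \<ge> 1 - k * u ^ 2" by linarith
  then have "((1 - u) * exp u) ^ k * ?E \<ge> (1 - k * u ^ 2) * ?E"
    by (intro mult_right_mono) auto
  then have low1: "(1 - u) ^ k \<ge> (1 - k * u ^ 2) * ?E"
    by (simp add: power_mult_distrib exp_of_nat_mult[symmetric] mult.assoc exp_add[symmetric])
  have up1: "(1 - u) ^ k \<le> ?E"
  proof -
    have "(1 - u) ^ k \<le> exp (- u) ^ k"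
      using u exp_ge_add_one_self[of "- u"] by (intro power_mono) auto
    then show ?thesis by (simp add: exp_of_nat_mult[symmetric])
  qed
  have up2: "exp (- x * u) \<le> ?E" using x u by (simp add: mult_right_mono)
  have "(1 - u) * ?E \<le> exp (- u) * ?E"
    using exp_ge_add_one_self[of "- u"] by (intro mult_right_mono) auto
  also have "\<dots> = exp (- ((k + 1) * u))"
    by (simp add: exp_add[symmetric] algebra_simps)
  also have "\<dots> \<le> exp (- x * u)"
    using mult_right_mono[OF x(2) u(1)] by (simp add: add.commute)
  finally have low2: "(1 - u) * ?E \<le> exp (- x * u)" .
  have "0 \<le> u * ?E" "0 \<le> k * u ^ 2 * ?E" using u by auto
  moreover have "(1 - u) * ?E = ?E - u * ?E" "(1 - k * u ^ 2) * ?E = ?E - k * u ^ 2 * ?E"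
    "u * (1 + k * u) * ?E = u * ?E + k * u ^ 2 * ?E"
    by (simp_all add: algebra_simps power2_eq_square)
  ultimately show ?thesis
    using low1 up1 low2 up2 unfolding abs_le_iff by linarith
qed

text \<open>
  The cubic \<open>(1 + t) (1 + t\<^sup>2)\<close> is dominated coefficientwise by \<open>27 (1 + t / 3)\<^sup>3\<close>, and
  \<open>1 + t / 3 \<le> exp (t / 3)\<close>; the constant \<open>27\<close> makes the leading coefficients agree.
\<close>

lemma linear_exp_minus_bound:
  fixes t :: real
  assumes "t \<ge> 0"
  shows "(1 + t) * exp (- t) \<le> 27 / (1 + t ^ 2)"
proof -
  have "27 * (1 + t / 3) ^ 3 = 27 + 27 * t + 9 * t ^ 2 + t ^ 3"
    by (simp add: power2_eq_square power3_eq_cube field_simps)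
  moreover have "(1 + t) * (1 + t ^ 2) = 1 + t + t ^ 2 + t ^ 3"
    by (simp add: power2_eq_square power3_eq_cube algebra_simps)
  ultimately have "(1 + t) * (1 + t ^ 2) \<le> 27 * (1 + t / 3) ^ 3"
    using assms zero_le_power2[of t] by linarith
  also have "\<dots> \<le> 27 * exp (t / 3) ^ 3"
    using assms by (intro mult_left_mono power_mono exp_ge_add_one_self) auto
  also have "exp (t / 3) ^ 3 = exp t"
    by (simp flip: exp_of_nat_mult)
  finally show ?thesis
    by (simp add: exp_minus field_simps add_pos_nonneg)
qed

text \<open>
  With \<open>q = \<surd>k\<close> this bounds the sum of \<open>1 / (n\<^sup>4 + k\<^sup>2)\<close> over \<open>n \<ge> 1\<close> by the telescoping value
  \<open>4 / q\<^sup>3\<close>. It holds because \<open>n\<^sup>4 + q\<^sup>4\<close> is, up to a constant, at least \<open>q\<^sup>2 (n + q)\<^sup>2\<close>.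
\<close>

lemma quartic_le_telescope:
  fixes n q :: real
  assumes "n \<ge> 0" "q > 0"
  shows "1 / ((n + 1) ^ 4 + q ^ 4) \<le> 4 / q ^ 2 * (1 / (n + q) - 1 / (n + 1 + q))"
proof -
  have "q ^ 2 * ((n + q) * (n + 1 + q)) \<le> q ^ 2 * (n + 1 + q) ^ 2"
    using assms by (intro mult_left_mono) (auto simp: power2_eq_square intro: mult_right_mono)
  also have "\<dots> \<le> q ^ 2 * (2 * ((n + 1) ^ 2 + q ^ 2))"
    using sum_squares_bound[of "n + 1" q]
    by (intro mult_left_mono) (auto simp: power2_eq_square algebra_simps)
  also have "\<dots> \<le> 4 * ((n + 1) ^ 4 + q ^ 4)"
  proof -
    have "b * (2 * (a + b)) \<le> 4 * (a ^ 2 + b ^ 2)" for a b :: real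
    proof -
      have "b * (2 * (a + b)) = 2 * a * b + 2 * b ^ 2"
        by (simp add: algebra_simps power2_eq_square)
      also have "\<dots> \<le> 4 * (a ^ 2 + b ^ 2)"
        using sum_squares_bound[of a b] zero_le_power2[of a] zero_le_power2[of b] by argo
      finally show ?thesis .
    qed
    from this[of "q ^ 2" "(n + 1) ^ 2"] show ?thesis by (simp flip: power_mult)
  qed
  finally have le: "q ^ 2 * ((n + q) * (n + 1 + q)) \<le> 4 * ((n + 1) ^ 4 + q ^ 4)" .
  have pos: "(n + 1) ^ 4 + q ^ 4 > 0" "q ^ 2 * ((n + q) * (n + 1 + q)) > 0"
    using assms by (auto intro!: add_nonneg_pos mult_pos_pos)
  have "1 / (n + q) - 1 / (n + 1 + q) = 1 / ((n + q) * (n + 1 + q))"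
    using assms by (simp add: field_simps)
  then have "4 / q ^ 2 * (1 / (n + q) - 1 / (n + 1 + q)) = 4 / (q ^ 2 * ((n + q) * (n + 1 + q)))"
    by simp
  moreover have "1 / ((n + 1) ^ 4 + q ^ 4) \<le> 4 / (q ^ 2 * ((n + q) * (n + 1 + q)))"
    using le pos by (simp add: divide_le_eq le_divide_eq)
  ultimately show ?thesis by simp
qed

text \<open>
  The exponent \<open>- 3 / 2\<close> of the error is the origin of the restriction on \<open>\<delta>\<close> in the theorem.
  The constant is the product of the \<open>27\<close> and the \<open>4\<close> of the two preceding lemmas.
\<close>

lemma Riesz_Baez_Duarte_close:
  assumes k: "k > 0" and x: "real k \<le> x" "x \<le> real k + 1"
  shows "\<bar>Riesz x / x - Baez_Duarte k\<bar> \<le> 108 * real k powr (- 3 / 2)"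
proof -
  define q where "q = sqrt (real k)"
  have q: "q > 0" "q ^ 2 = k" using k by (simp_all add: q_def)
  let ?d = "\<lambda>n. mobius (Suc n) * inv_square n * (exp (- x * inv_square n) - (1 - inv_square n) ^ k)"
  let ?h = "\<lambda>n. 108 / q ^ 2 * (1 / (real n + q) - 1 / (real (Suc n) + q))"
  have d: "?d sums (Riesz x / x - Baez_Duarte k)"
    using sums_diff[OF Riesz_mobius Baez_Duarte_mobius, of x k] k x by (simp add: algebra_simps)
  have "(\<lambda>n. 1 / (real n + q)) \<longlonglongrightarrow> 0"
    by (intro real_tendsto_divide_at_top[OF tendsto_const] filterlim_at_top_add_at_top
        filterlim_at_top_mono[OF filterlim_real_sequentially]) (use q in auto)
  from sums_mult[OF telescope_sums'[OF this], of "108 / q ^ 2"]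
  have h: "?h sums (108 / q ^ 3)"
    by (simp add: power3_eq_cube power2_eq_square)
  have dh: "\<bar>?d n\<bar> \<le> ?h n" for n
  proof -
    define u where "u = inv_square n"
    have u: "0 < u" "u \<le> 1" unfolding u_def by (rule inv_square_bounds)+
    have "\<bar>?d n\<bar> = \<bar>mobius (Suc n)\<bar> * (u * \<bar>exp (- x * u) - (1 - u) ^ k\<bar>)"
      using u by (simp add: abs_mult u_def)
    also have "\<dots> \<le> 1 * (u * (u * (1 + k * u) * exp (- (k * u))))"
      using u x by (intro mult_mono mult_left_mono abs_mobius_le_1 exp_minus_power_bound) auto
    also have "\<dots> = u ^ 2 * ((1 + k * u) * exp (- (k * u)))"
      by (simp add: power2_eq_square)
    also have "\<dots> \<le> u ^ 2 * (27 / (1 + (k * u) ^ 2))"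
      using u by (intro mult_left_mono linear_exp_minus_bound) auto
    also have "\<dots> = 27 * (1 / ((real n + 1) ^ 4 + q ^ 4))"
    proof -
      have "q ^ 4 = real k ^ 2" using q by (simp flip: q(2) power_mult)
      moreover define M where "M = (real n + 1) ^ 2"
      moreover have "M > 0" "u = 1 / M"
        by (simp_all add: u_def inv_square_def M_def add.commute)
      moreover from this have "M ^ 2 * (1 + (k * u) ^ 2) = M ^ 2 + real k ^ 2"
        by (simp add: distrib_left power_divide)
      ultimately show ?thesis
        by (simp add: power_divide flip: power_mult)
    qed
    also have "\<dots> \<le> 27 * (4 / q ^ 2 * (1 / (real n + q) - 1 / (real n + 1 + q)))"
      using q by (intro mult_left_mono quartic_le_telescope) auto
    also have "\<dots> = ?h n" by (simp add: add_ac)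
    finally show ?thesis .
  qed
  have "Riesz x / x - Baez_Duarte k \<le> 108 / q ^ 3"
    by (rule sums_le[OF _ d h]) (use dh in \<open>simp add: abs_le_iff\<close>)
  moreover have "- (Riesz x / x - Baez_Duarte k) \<le> 108 / q ^ 3"
    by (rule sums_le[OF _ sums_minus[OF d] h]) (use dh in \<open>simp add: abs_le_iff\<close>)
  moreover have "1 / q ^ 3 = real k powr (- 3 / 2)"
  proof -
    have "q ^ 3 = real k powr (1 / 2 * 3)"
      using k unfolding q_def by (simp add: powr_half_sqrt[symmetric] powr_power)
    then show ?thesis by (simp add: powr_minus_divide)
  qed
  ultimately show ?thesis by (simp add: abs_le_iff field_simps)
qed


section \<open>Transfer of the growth bounds\<close>

lemma nat_floor_bounds:
  assumes "x \<ge> (1::real)"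
  shows "nat \<lfloor>x\<rfloor> > 0" "real (nat \<lfloor>x\<rfloor>) \<le> x" "x \<le> real (nat \<lfloor>x\<rfloor>) + 1"
proof -
  have "real (nat \<lfloor>x\<rfloor>) = of_int \<lfloor>x\<rfloor>" using assms by simp
  then show "real (nat \<lfloor>x\<rfloor>) \<le> x" "x \<le> real (nat \<lfloor>x\<rfloor>) + 1"
    using floor_correct[of x] by linarith+
  show "nat \<lfloor>x\<rfloor> > 0" using assms by simp
qed

text \<open>
  For \<open>x \<ge> 1\<close> the ratio of \<open>x\<close> to its floor lies between \<open>1\<close> and \<open>2\<close>; for negative \<open>a\<close> this costs
  the factor \<open>2 powr \<bar>a\<bar>\<close>.
\<close>

lemma floor_powr_bigo:
  "(\<lambda>x. real (nat \<lfloor>x\<rfloor>) powr a) \<in> O[at_top](\<lambda>x. x powr a)"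
proof (rule bigoI)
  show "\<forall>\<^sub>F x in at_top. norm (real (nat \<lfloor>x\<rfloor>) powr a) \<le> 2 powr \<bar>a\<bar> * norm (x powr a)"
    using eventually_ge_at_top[of 1]
  proof eventually_elim
    case (elim x)
    define k where "k = real (nat \<lfloor>x\<rfloor>)"
    have k: "1 \<le> k" "k \<le> x" "x \<le> k + 1"
      using nat_floor_bounds[OF elim] by (simp_all add: k_def del: of_nat_nat)
    show ?case
    proof (cases "a \<ge> 0")
      case True
      have "k powr a \<le> x powr a" using k True by (intro powr_mono2) auto
      moreover have "1 \<le> (2::real) powr a" using True by (simp add: ge_one_powr_ge_zero)
      ultimately have "1 * k powr a \<le> 2 powr a * x powr a" by (intro mult_mono) auto
      then show ?thesis using True by (simp add: k_def)
    next
      case False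
      have "k powr a \<le> (x / 2) powr a" using k False by (intro powr_mono2') auto
      also have "\<dots> = 2 powr \<bar>a\<bar> * x powr a"
        using k False by (simp add: powr_divide powr_minus_divide)
      finally show ?thesis by (simp add: k_def)
    qed
  qed
qed

lemma nat_floor_at_top: "filterlim (\<lambda>x::real. nat \<lfloor>x\<rfloor>) at_top at_top"
  by (intro filterlim_compose[OF filterlim_nat_sequentially] filterlim_floor_sequentially)

theorem theorem1:
  fixes \<delta> :: real
  assumes "\<delta> > - 3 / 2"
  shows "Riesz \<in> O[at_top](\<lambda>x. x powr (\<delta> + 1)) \<longleftrightarrow>
         Baez_Duarte \<in> O[at_top](\<lambda>k. real k powr \<delta>)"
proof -
  let ?b = "\<lambda>x. Baez_Duarte (nat \<lfloor>x\<rfloor>)"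
  have "Riesz \<in> O[at_top](\<lambda>x. x powr (\<delta> + 1)) \<longleftrightarrow>
      (\<lambda>x. x * (Riesz x / x)) \<in> O[at_top](\<lambda>x. x * x powr \<delta>)"
    by (intro landau_o.big.cong_ex eventually_mono[OF eventually_gt_at_top[of 0]])
      (auto simp: powr_add)
  also have "\<dots> \<longleftrightarrow> (\<lambda>x. Riesz x / x) \<in> O[at_top](\<lambda>x. x powr \<delta>)"
    by (intro landau_o.big.mult_cancel_left eventually_mono[OF eventually_gt_at_top[of 0]]) auto
  (* the two functions differ by a function that is itself O(x powr delta) *)
  also have "\<dots> \<longleftrightarrow> ?b \<in> O[at_top](\<lambda>x. x powr \<delta>)"
  proof -
    have "(\<lambda>x. Riesz x / x - ?b x) \<in> O[at_top](\<lambda>x. real (nat \<lfloor>x\<rfloor>) powr (- 3 / 2))"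
    proof (rule bigoI)
      show "\<forall>\<^sub>F x in at_top. norm (Riesz x / x - ?b x) \<le> 108 * norm (real (nat \<lfloor>x\<rfloor>) powr (- 3 / 2))"
        using eventually_ge_at_top[of 1]
      proof eventually_elim
        case (elim x)
        from Riesz_Baez_Duarte_close[OF nat_floor_bounds[OF elim]] show ?case by simp
      qed
    qed
    also note floor_powr_bigo
    also have "(\<lambda>x::real. x powr (- 3 / 2)) \<in> O[at_top](\<lambda>x. x powr \<delta>)"
      by (rule bigoI[where c = 1], rule eventually_mono[OF eventually_ge_at_top[of 1]])
        (use assms in \<open>auto intro: powr_mono\<close>)
    finally have diff: "(\<lambda>x. Riesz x / x - ?b x) \<in> O[at_top](\<lambda>x. x powr \<delta>)" .
    show ?thesis
      using sum_in_bigo(2)[OF _ diff, of "\<lambda>x. Riesz x / x"] sum_in_bigo(1)[OF _ diff, of ?b]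
      by auto
  qed
  also have "\<dots> \<longleftrightarrow> Baez_Duarte \<in> O[at_top](\<lambda>k. real k powr \<delta>)"
  proof
    assume "?b \<in> O[at_top](\<lambda>x. x powr \<delta>)"
    from landau_o.big.compose[OF this filterlim_real_sequentially]
    show "Baez_Duarte \<in> O[at_top](\<lambda>k. real k powr \<delta>)" by simp
  next
    assume "Baez_Duarte \<in> O[at_top](\<lambda>k. real k powr \<delta>)"
    from landau_o.big.compose[OF this nat_floor_at_top]
    show "?b \<in> O[at_top](\<lambda>x. x powr \<delta>)"
      by (rule landau_o.big_trans[OF _ floor_powr_bigo])
  qed
  finally show ?thesis .
qed

end
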